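(* Let $(X_n)_{n\ge 0}$ be the random walk on $\{0,1,2,\dots\}$ with jump distribution $(p_k)_{k\ge0}$ at the origin. If $p_0=1$ (so $p_k=0$ for all $k\ge1$), then $$E(X_n\mid X_0=j)=j\qquad\text{for all integers } j,n\ge 0.$$
   Context: The random walk $(X_n)_{n\ge0}$ is the discrete-time, time-homogeneous Markov chain on $\{0,1,2,\dots\}$ with transition probabilities $P(X_{n+1}=j-1\mid X_n=j)=P(X_{n+1}=j+1\mid X_n=j)=\frac12$ for $j\ge 1$, and $P(X_{n+1}=k\mid X_n=0)=p_k$ for $k\ge 0$, where $p_k\ge 0$ and $\sum_{k\ge0}p_k=1$. The expected position is $E(X_n\mid X_0=j)=\sum_{k=0}^\infty k\,P(X_n=k\mid X_0=j)$. *)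

theory Defs
  imports "HOL-Probability.Probability"
begin

definition transition :: "(nat \<Rightarrow> real) \<Rightarrow> nat \<Rightarrow> nat \<Rightarrow> real" where
  "transition p j k =
     (if j = 0 then p k
      else if k = j - 1 \<or> k = j + 1 then 1 / 2
      else 0)"

(* The initial distribution is arbitrary.  The condition on positive-probability histories is
   needed because cond_prob is 0 when the conditioning event has probability 0. *)
locale random_walk = prob_space M
  for M :: "'a measure" and p :: "nat \<Rightarrow> real" and X :: "nat \<Rightarrow> 'a \<Rightarrow> nat" +
  assumes jump_nonneg: "\<And>k. 0 \<le> p k"
    and jump_sums: "p sums 1"
    and random_variable_X: "\<And>n. random_variable (count_space UNIV) (X n)"
    and markov: "\<And>n x k. \<P>(\<omega> in M. \<forall>i\<le>n. X i \<omega> = x i) > 0 \<Longrightarrow>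
      \<P>(\<omega> in M. X (Suc n) \<omega> = k \<bar> \<forall>i\<le>n. X i \<omega> = x i) = transition p (x n) k"

(* The series is taken in ennreal, so that it is always defined and a finite value
   means genuine convergence. *)
definition expected_position :: "'a measure \<Rightarrow> (nat \<Rightarrow> 'a \<Rightarrow> nat) \<Rightarrow> nat \<Rightarrow> nat \<Rightarrow> ennreal" where
  "expected_position M X n j =
     (\<Sum>k. of_nat k * ennreal \<P>(\<omega> in M. X n \<omega> = k \<bar> X 0 \<omega> = j))"

end

theory Submission
  imports Defs
begin

text \<open>
  When \<open>p 0 = 1\<close> the origin is absorbing, so every row of the transition matrix has mean equal to
  its starting state (\<open>transition_mean\<close>): the walk is a nonnegative martingale.

  The Markov property concerns whole histories, so the induction is over histories too: for each
  cylinder event \<open>history m x\<close>, the integral of \<open>X (m + n)\<close> over it is \<open>x m\<close> times its probability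
  (\<open>nn_integral_history\<close>). Inducting on the remaining time \<open>n\<close> means that each step only splits a
  cylinder according to the next position, which is a single series over the naturals; summing over
  all histories of a given length is avoided. The case \<open>m = 0\<close>, where the cylinder is the event
  \<open>X 0 = j\<close>, is the claim up to division by the probability of that event. All integrals and series
  live in \<^typ>\<open>ennreal\<close>, where monotone convergence justifies interchanging them.
\<close>

lemma sums_single_term_imp_others_zero:
  fixes p :: "nat \<Rightarrow> real"
  assumes "\<And>k. 0 \<le> p k" and "p sums p i" and "k \<noteq> i"
  shows "p k = 0"
proof -
  have "sum p {i, k} \<le> suminf p"
    using assms by (intro sum_le_suminf) (auto dest: sums_summable)
  then have "p i + p k \<le> p i"
    using assms by (simp add: sums_unique[symmetric])
  then show ?thesis
    using assms(1)[of k] by simp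
qed

lemma transition_mean:
  assumes absorbing: "\<And>k. k \<noteq> 0 \<Longrightarrow> p k = 0"
  shows "(\<Sum>k. of_nat k * ennreal (transition p i k)) = of_nat i"
proof (cases i)
  case 0
  have "(\<lambda>k. of_nat k * ennreal (transition p 0 k)) = (\<lambda>_. 0)"
  proof
    show "of_nat k * ennreal (transition p 0 k) = 0" for k
      using absorbing by (cases "k = 0") (auto simp: transition_def)
  qed
  then show ?thesis
    using 0 by (simp only: suminf_zero of_nat_0)
next
  case (Suc i')
  have term_eq: "of_nat k * ennreal (transition p i k) = ennreal (real k * transition p i k)" for k
    using Suc by (simp add: transition_def ennreal_of_nat_eq_real_of_nat ennreal_mult'')
  have "(\<Sum>k. of_nat k * ennreal (transition p i k))
      = (\<Sum>k\<in>{i', Suc (Suc i')}. of_nat k * ennreal (transition p i k))"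
    using Suc by (intro suminf_finite) (auto simp: transition_def)
  also have "\<dots> = ennreal (\<Sum>k\<in>{i', Suc (Suc i')}. real k * transition p i k)"
    unfolding term_eq using Suc by (intro sum_ennreal) (auto simp: transition_def)
  also have "(\<Sum>k\<in>{i', Suc (Suc i')}. real k * transition p i k) = real i"
    using Suc by (simp add: transition_def field_simps)
  finally show ?thesis
    by (simp add: ennreal_of_nat_eq_real_of_nat)
qed

lemma nn_integral_split_by_value:
  fixes Y :: "'a \<Rightarrow> nat"
  assumes [measurable]: "f \<in> borel_measurable M" "A \<in> sets M" "Y \<in> measurable M (count_space UNIV)"
  shows "(\<integral>\<^sup>+\<omega>. f \<omega> * indicator A \<omega> \<partial>M)
    = (\<Sum>k. \<integral>\<^sup>+\<omega>. f \<omega> * indicator {\<omega>\<in>A. Y \<omega> = k} \<omega> \<partial>M)"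
proof -
  have [measurable]: "{\<omega>\<in>A. Y \<omega> = k} \<in> sets M" for k
  proof -
    have "{\<omega>\<in>A. Y \<omega> = k} = A \<inter> {\<omega>\<in>space M. Y \<omega> = k}"
      using sets.sets_into_space[OF assms(2)] by auto
    then show ?thesis by simp
  qed
  have "f \<omega> * indicator A \<omega> = (\<Sum>k. f \<omega> * indicator {\<omega>\<in>A. Y \<omega> = k} \<omega>)" for \<omega>
    by (subst suminf_finite[of "{Y \<omega>}"]) (auto simp: indicator_def)
  then have "(\<integral>\<^sup>+\<omega>. f \<omega> * indicator A \<omega> \<partial>M)
    = (\<integral>\<^sup>+\<omega>. (\<Sum>k. f \<omega> * indicator {\<omega>\<in>A. Y \<omega> = k} \<omega>) \<partial>M)"
    by simp
  also have "\<dots> = (\<Sum>k. \<integral>\<^sup>+\<omega>. f \<omega> * indicator {\<omega>\<in>A. Y \<omega> = k} \<omega> \<partial>M)"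
    by (intro nn_integral_suminf) measurable
  finally show ?thesis .
qed

context random_walk
begin

declare random_variable_X [measurable]

definition history :: "nat \<Rightarrow> (nat \<Rightarrow> nat) \<Rightarrow> 'a set" where
  "history m x = {\<omega> \<in> space M. \<forall>i\<le>m. X i \<omega> = x i}"

lemma history_in_sets [measurable]: "history m x \<in> sets M"
  unfolding history_def by measurable

lemma history_extend:
  "{\<omega> \<in> history m x. X (Suc m) \<omega> = k} = history (Suc m) (x(Suc m := k))"
  unfolding history_def by (auto simp: le_Suc_eq)

lemma emeasure_history_extend:
  "emeasure M (history (Suc m) (x(Suc m := k)))
    = ennreal (transition p (x m) k) * emeasure M (history m x)"
proof (cases "prob (history m x) > 0")
  case True
  have "\<P>(\<omega> in M. X (Suc m) \<omega> = k \<bar> \<forall>i\<le>m. X i \<omega> = x i) = transition p (x m) k"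
    using True by (intro markov) (simp add: history_def)
  moreover have "{\<omega> \<in> space M. X (Suc m) \<omega> = k \<and> (\<forall>i\<le>m. X i \<omega> = x i)}
      = history (Suc m) (x(Suc m := k))"
    by (auto simp: history_extend[symmetric] history_def)
  ultimately have "prob (history (Suc m) (x(Suc m := k)))
      = transition p (x m) k * prob (history m x)"
    using True by (simp add: cond_prob_def history_def field_simps)
  then show ?thesis
    by (simp add: emeasure_eq_measure ennreal_mult'')
next
  \<comment> \<open>The Markov hypothesis is silent on null histories, but an extension of one is null as well.\<close>
  case False
  then have null: "prob (history m x) = 0"
    by (simp add: zero_less_measure_iff)
  have "history (Suc m) (x(Suc m := k)) \<subseteq> history m x"
    by (auto simp: history_extend[symmetric])
  then have "prob (history (Suc m) (x(Suc m := k))) \<le> 0"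
    unfolding null[symmetric] by (rule finite_measure_mono) simp
  then show ?thesis
    using null by (simp add: emeasure_eq_measure measure_le_0_iff)
qed

text \<open>
  The martingale property, conditional on a history and with horizon \<open>n\<close>. The history is generalised
  in the induction because splitting off the first of \<open>n + 1\<close> steps leaves \<open>n\<close> steps started from a
  history that is longer by one.
\<close>

lemma nn_integral_history:
  assumes absorbing: "\<And>k. k \<noteq> 0 \<Longrightarrow> p k = 0"
  shows "(\<integral>\<^sup>+\<omega>. of_nat (X (m + n) \<omega>) * indicator (history m x) \<omega> \<partial>M)
    = of_nat (x m) * emeasure M (history m x)"
proof (induction n arbitrary: m x)
  case 0
  have "(\<integral>\<^sup>+\<omega>. of_nat (X m \<omega>) * indicator (history m x) \<omega> \<partial>M)
      = (\<integral>\<^sup>+\<omega>. of_nat (x m) * indicator (history m x) \<omega> \<partial>M)"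
    by (intro nn_integral_cong) (auto simp: history_def indicator_def)
  then show ?case
    by (simp add: nn_integral_cmult_indicator)
next
  case (Suc n)
  have "(\<integral>\<^sup>+\<omega>. of_nat (X (m + Suc n) \<omega>) * indicator (history m x) \<omega> \<partial>M)
      = (\<Sum>k. \<integral>\<^sup>+\<omega>. of_nat (X (Suc m + n) \<omega>)
          * indicator (history (Suc m) (x(Suc m := k))) \<omega> \<partial>M)"
    by (subst nn_integral_split_by_value[where Y = "X (Suc m)"]) (simp_all add: history_extend)
  also have "\<dots> = (\<Sum>k. of_nat k * ennreal (transition p (x m) k) * emeasure M (history m x))"
    by (simp only: Suc.IH emeasure_history_extend fun_upd_same mult.assoc)
  also have "\<dots> = of_nat (x m) * emeasure M (history m x)"
    using absorbing by (simp add: transition_mean)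
  finally show ?case .
qed

lemma expected_position_eq_nn_integral:
  assumes pos: "\<P>(\<omega> in M. X 0 \<omega> = j) > 0"
  shows "expected_position M X n j * ennreal \<P>(\<omega> in M. X 0 \<omega> = j)
    = (\<integral>\<^sup>+\<omega>. of_nat (X n \<omega>) * indicator {\<omega>\<in>space M. X 0 \<omega> = j} \<omega> \<partial>M)"
proof -
  let ?A = "{\<omega>\<in>space M. X 0 \<omega> = j}"
  have term_eq: "of_nat k * ennreal \<P>(\<omega> in M. X n \<omega> = k \<bar> X 0 \<omega> = j) * ennreal (prob ?A)
      = (\<integral>\<^sup>+\<omega>. of_nat (X n \<omega>) * indicator {\<omega>\<in>?A. X n \<omega> = k} \<omega> \<partial>M)" for k
  proof -
    have eq: "{\<omega>\<in>?A. X n \<omega> = k} = {\<omega>\<in>space M. X n \<omega> = k \<and> X 0 \<omega> = j}"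
      by auto
    have "ennreal \<P>(\<omega> in M. X n \<omega> = k \<bar> X 0 \<omega> = j) * ennreal (prob ?A)
        = emeasure M {\<omega>\<in>?A. X n \<omega> = k}"
      using pos unfolding eq by (simp add: cond_prob_def emeasure_eq_measure flip: ennreal_mult'')
    then have "of_nat k * ennreal \<P>(\<omega> in M. X n \<omega> = k \<bar> X 0 \<omega> = j) * ennreal (prob ?A)
        = of_nat k * emeasure M {\<omega>\<in>?A. X n \<omega> = k}"
      by (simp add: mult.assoc)
    also have "\<dots> = (\<integral>\<^sup>+\<omega>. of_nat k * indicator {\<omega>\<in>?A. X n \<omega> = k} \<omega> \<partial>M)"
      unfolding eq by (subst nn_integral_cmult_indicator) simp_all
    also have "\<dots> = (\<integral>\<^sup>+\<omega>. of_nat (X n \<omega>) * indicator {\<omega>\<in>?A. X n \<omega> = k} \<omega> \<partial>M)"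
      by (intro nn_integral_cong) (auto simp: indicator_def)
    finally show ?thesis .
  qed
  show ?thesis
    unfolding expected_position_def
    by (subst nn_integral_split_by_value[where Y = "X n"])
      (simp_all add: term_eq flip: ennreal_suminf_multc)
qed

end

theorem proposition1:
  fixes M :: "'a measure" and p :: "nat \<Rightarrow> real" and X :: "nat \<Rightarrow> 'a \<Rightarrow> nat"
    and j n :: nat
  assumes "random_walk M p X"
    and "p 0 = 1"
    and "\<P>(\<omega> in M. X 0 \<omega> = j) > 0"
  shows "expected_position M X n j = of_nat j"
proof -
  interpret random_walk M p X by fact
  let ?a = "ennreal \<P>(\<omega> in M. X 0 \<omega> = j)"
  have absorbing: "p k = 0" if "k \<noteq> 0" for k
    using sums_single_term_imp_others_zero[of p 0 k] jump_nonneg jump_sums assms(2) that by simp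
  have start: "history 0 (\<lambda>_. j) = {\<omega>\<in>space M. X 0 \<omega> = j}"
    by (simp add: history_def)
  have "expected_position M X n j * ?a = of_nat j * ?a"
    using nn_integral_history[OF absorbing, of 0 n "\<lambda>_. j"]
      expected_position_eq_nn_integral[OF assms(3), of n]
    by (simp add: start emeasure_eq_measure)
  moreover have "?a \<noteq> 0" "?a \<noteq> top"
    using assms(3) by simp_all
  ultimately show ?thesis
    by (metis ennreal_mult_cancel_left mult.commute)
qed

end
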